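(* Let $M_\alpha=\begin{pmatrix}\alpha_{11}&\alpha_{12}\\ \alpha_{21}&\alpha_{22}\end{pmatrix}$ have entries $\alpha_{ii'}\ge 0$ and $\det M_\alpha\ne 0$, and set $\kappa_1=\frac{\alpha_{22}-\alpha_{12}}{\det M_\alpha}$, $\kappa_2=\frac{\alpha_{11}-\alpha_{21}}{\det M_\alpha}$. Let $\mathbf{p}=(p^a,p^b)\in\mathbb{R}_{\ge0}^2$ and let $\boldsymbol\sigma$ be a selection of the game $M_\alpha$. Then the following are equivalent. (A) There is a neighborhood $P$ of $\mathbf{p}$ on which $\boldsymbol\sigma$ is continuous, $\mathbf{p}$ is a local maximum for $\boldsymbol\sigma$, and both firms have positive profit at $\mathbf{p}$ (i.e. $\Pi^a(\mathbf{p})>0$ and $\Pi^b(\mathbf{p})>0$). (B) The following three conditions hold: (i) $\kappa_1+\kappa_2<0$; (ii) there is a neighborhood $P$ of $\mathbf{p}$ such that both groups split in $\boldsymbol\sigma|_P$, i.e. $0<\sigma_i(\mathbf{q})<1$ for $i=1,2$ and all $\mathbf{q}\in P$; (iii) $p^a=p^b=p^*=\dfrac{2}{|\kappa_1+\kappa_2|}$.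
   Context: Two firms $a,b$ set prices $\mathbf{p}=(p^a,p^b)\in\mathbb{R}_{\ge0}^2$; then two groups of consumers, each of size $1$, choose a firm (total coverage). Consumer choices are represented by $\boldsymbol{\sigma}=(\sigma_1,\sigma_2)\in[0,1]^2$, where $\sigma_i$ is the proportion of group $i$ choosing $a$. The interaction structure is a real matrix $M_\alpha=(\alpha_{ii'})$ with $\alpha_{ii'}\ge0$ and $\det M_\alpha\neq0$. A member of group $i$ gets $v_i(a;\boldsymbol\sigma)=-p^a+\alpha_{i1}\sigma_1+\alpha_{i2}\sigma_2$ from $a$ and $v_i(b;\boldsymbol\sigma)=-p^b+\alpha_{i1}(1-\sigma_1)+\alpha_{i2}(1-\sigma_2)$ from $b$. Put $$\Delta v_i(\mathbf{p},\boldsymbol\sigma)=-(p^a-p^b)+\alpha_{i1}(2\sigma_1-1)+\alpha_{i2}(2\sigma_2-1).$$ $\boldsymbol\sigma$ represents a second-stage Nash equilibrium at $\mathbf{p}$, written $\boldsymbol\sigma\in E(\mathbf{p})$, if for each $i\in\{1,2\}$: $\sigma_i=1$ implies $\Delta v_i\ge0$; $\sigma_i=0$ implies $\Delta v_i\le0$; $0<\sigma_i<1$ implies $\Delta v_i=0$. A selection is a function $\boldsymbol\sigma:\mathbb{R}_{\ge0}^2\to[0,1]^2$ with $\boldsymbol\sigma(\mathbf{p})\in E(\mathbf{p})$ for all $\mathbf{p}$. It induces demand functions $D^a=\sigma_1+\sigma_2$, $D^b=2-(\sigma_1+\sigma_2)$, and profits $\Pi^j(\mathbf{p})=p^jD^j(\mathbf{p})$,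 $j=a,b$. The pair $\mathbf{p}$ is a local maximum for $\boldsymbol\sigma$ (a local equilibrium of the pricing game) if $p^a$ is a local maximizer of $p\mapsto\Pi^a(p,p^b)$ on $\mathbb{R}_{\ge0}$ and $p^b$ is a local maximizer of $p\mapsto\Pi^b(p^a,p)$ on $\mathbb{R}_{\ge0}$. Neighborhoods are taken in $\mathbb{R}_{\ge0}^2$. *)

theory Defs
  imports "HOL-Analysis.Analysis"
begin

(* A price pair p is (price of firm a, price of firm b); a consumer profile s :: real^2 has
   s $ i = share of group i choosing firm a; an interaction structure is a matrix
   \<alpha> :: real^2^2 with \<alpha> $ i $ j the weight that group i puts on group j. *)

definition price_space :: "(real \<times> real) set" where
  "price_space = {0..} \<times> {0..}"

(* Neighborhoods are relative to price_space and need not be open. *)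
definition price_nhd :: "real \<times> real \<Rightarrow> (real \<times> real) set \<Rightarrow> bool" where
  "price_nhd p P \<longleftrightarrow> P \<subseteq> price_space \<and>
     (\<exists>U. openin (top_of_set price_space) U \<and> p \<in> U \<and> U \<subseteq> P)"

definition value_a :: "real^2^2 \<Rightarrow> real \<times> real \<Rightarrow> real^2 \<Rightarrow> 2 \<Rightarrow> real" where
  "value_a \<alpha> p s i = - fst p + \<alpha> $ i $ 1 * s $ 1 + \<alpha> $ i $ 2 * s $ 2"

definition value_b :: "real^2^2 \<Rightarrow> real \<times> real \<Rightarrow> real^2 \<Rightarrow> 2 \<Rightarrow> real" where
  "value_b \<alpha> p s i = - snd p + \<alpha> $ i $ 1 * (1 - s $ 1) + \<alpha> $ i $ 2 * (1 - s $ 2)"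

definition value_diff :: "real^2^2 \<Rightarrow> real \<times> real \<Rightarrow> real^2 \<Rightarrow> 2 \<Rightarrow> real" where
  "value_diff \<alpha> p s i =
     - (fst p - snd p) + \<alpha> $ i $ 1 * (2 * s $ 1 - 1) + \<alpha> $ i $ 2 * (2 * s $ 2 - 1)"

lemma value_diff_eq: "value_diff \<alpha> p s i = value_a \<alpha> p s i - value_b \<alpha> p s i"
  by (simp add: value_diff_def value_a_def value_b_def algebra_simps)

definition stage2_equilibria :: "real^2^2 \<Rightarrow> real \<times> real \<Rightarrow> (real^2) set" where
  "stage2_equilibria \<alpha> p = {s. \<forall>i. s $ i \<in> {0..1} \<and>
     (s $ i = 1 \<longrightarrow> value_diff \<alpha> p s i \<ge> 0) \<and>
     (s $ i = 0 \<longrightarrow> value_diff \<alpha> p s i \<le> 0) \<and>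
     (0 < s $ i \<and> s $ i < 1 \<longrightarrow> value_diff \<alpha> p s i = 0)}"

(* Values of \<sigma> outside price_space are irrelevant. *)
definition selection :: "real^2^2 \<Rightarrow> (real \<times> real \<Rightarrow> real^2) \<Rightarrow> bool" where
  "selection \<alpha> \<sigma> \<longleftrightarrow> (\<forall>p\<in>price_space. \<sigma> p \<in> stage2_equilibria \<alpha> p)"

definition demand_a :: "(real \<times> real \<Rightarrow> real^2) \<Rightarrow> real \<times> real \<Rightarrow> real" where
  "demand_a \<sigma> p = \<sigma> p $ 1 + \<sigma> p $ 2"

definition demand_b :: "(real \<times> real \<Rightarrow> real^2) \<Rightarrow> real \<times> real \<Rightarrow> real" where
  "demand_b \<sigma> p = 2 - (\<sigma> p $ 1 + \<sigma> p $ 2)"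

definition profit_a :: "(real \<times> real \<Rightarrow> real^2) \<Rightarrow> real \<times> real \<Rightarrow> real" where
  "profit_a \<sigma> p = fst p * demand_a \<sigma> p"

definition profit_b :: "(real \<times> real \<Rightarrow> real^2) \<Rightarrow> real \<times> real \<Rightarrow> real" where
  "profit_b \<sigma> p = snd p * demand_b \<sigma> p"

definition local_maximizer_on :: "real set \<Rightarrow> (real \<Rightarrow> real) \<Rightarrow> real \<Rightarrow> bool" where
  "local_maximizer_on S f x \<longleftrightarrow> x \<in> S \<and> (\<forall>\<^sub>F y in at x within S. f y \<le> f x)"

definition local_maximum :: "(real \<times> real \<Rightarrow> real^2) \<Rightarrow> real \<times> real \<Rightarrow> bool" where
  "local_maximum \<sigma> p \<longleftrightarrow>
     local_maximizer_on {0..} (\<lambda>q. profit_a \<sigma> (q, snd p)) (fst p) \<and>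
     local_maximizer_on {0..} (\<lambda>q. profit_b \<sigma> (fst p, q)) (snd p)"

definition kappa1 :: "real^2^2 \<Rightarrow> real" where
  "kappa1 \<alpha> = (\<alpha> $ 2 $ 2 - \<alpha> $ 1 $ 2) / det \<alpha>"

definition kappa2 :: "real^2^2 \<Rightarrow> real" where
  "kappa2 \<alpha> = (\<alpha> $ 1 $ 1 - \<alpha> $ 2 $ 1) / det \<alpha>"

end

(* If both groups split near p, the two indifference conditions form a linear system with solution
   2 \<sigma>_i - 1 = \<kappa>_i (p^a - p^b), so demand is affine and the equivalence reduces to the first-order
   conditions of two quadratic profits.  If some group does not split at p, a firm with positive
   profit can be at a local maximum only if raising its price strictly lowers its demand; comparing
   the equilibria after a small increase of p^a and after an equal increase of p^b shows that the
   demands cannot both react in this way, because the interaction weights are nonnegative. *)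

theory Submission
  imports Defs
begin

section \<open>Equilibria in which some group does not split\<close>

text \<open>The equilibrium condition of one group, over plain reals: exchanging the two firms then
  amounts to replacing \<open>s\<close> by \<open>1 - s\<close> and \<open>v\<close> by
  \<open>- v\<close>.\<close>

definition best_reply :: "real \<Rightarrow> real \<Rightarrow> bool" where
  "best_reply s v \<longleftrightarrow> 0 \<le> s \<and> s \<le> 1 \<and> (s = 1 \<longrightarrow> 0 \<le> v) \<and> (s = 0 \<longrightarrow> v \<le> 0) \<and>
     (0 < s \<and> s < 1 \<longrightarrow> v = 0)"

text \<open>The strict inequalities at the base point \<open>(s, v)\<close> are open conditions, so
  continuity carries them to \<open>(s', v')\<close> after a small price change. This is the only
  form in which continuity enters the algebra of this section.\<close>

definition nearby :: "real \<Rightarrow> real \<Rightarrow> real \<Rightarrow> real \<Rightarrow> bool" where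
  "nearby s v s' v' \<longleftrightarrow>
     (0 < s \<longrightarrow> 0 < s') \<and> (s < 1 \<longrightarrow> s' < 1) \<and> (0 < v \<longrightarrow> 0 < v') \<and> (v < 0 \<longrightarrow> v' < 0)"

definition utility_gap :: "real \<Rightarrow> real \<Rightarrow> real \<Rightarrow> real \<Rightarrow> real \<Rightarrow> real" where
  "utility_gap a b d s t = - d + a * (2 * s - 1) + b * (2 * t - 1)"

lemma best_reply_reflect: "best_reply (1 - s) (- v) \<longleftrightarrow> best_reply s v"
  by (auto simp: best_reply_def)

lemma nearby_reflect: "nearby (1 - s) (- v) (1 - s') (- v') \<longleftrightarrow> nearby s v s' v'"
  by (auto simp: nearby_def)

lemma utility_gap_reflect: "utility_gap a b (- d) (1 - s) (1 - t) = - utility_gap a b d s t"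
  by (simp add: utility_gap_def algebra_simps)

text \<open>The profile \<open>x\<close> is played after firm \<open>a\<close> raises its price by \<open>e\<close>, the profile \<open>y\<close> after
  firm \<open>b\<close> does; each firm loses customers by its own deviation.\<close>

definition demand_responsive ::
    "real \<Rightarrow> real \<Rightarrow> real \<Rightarrow> real \<Rightarrow> real \<Rightarrow> real \<Rightarrow> real \<Rightarrow> real \<Rightarrow> real \<Rightarrow> real \<Rightarrow> real \<Rightarrow> real \<Rightarrow> bool" where
  "demand_responsive a11 a12 a21 a22 d e s1 s2 x1 x2 y1 y2 \<longleftrightarrow>
     0 \<le> a11 \<and> 0 \<le> a12 \<and> 0 \<le> a21 \<and> 0 \<le> a22 \<and> 0 < e \<and>
     x1 + x2 < s1 + s2 \<and> s1 + s2 < y1 + y2 \<and>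
     best_reply s1 (utility_gap a11 a12 d s1 s2) \<and>
     best_reply s2 (utility_gap a21 a22 d s1 s2) \<and>
     best_reply x1 (utility_gap a11 a12 (d + e) x1 x2) \<and>
     best_reply x2 (utility_gap a21 a22 (d + e) x1 x2) \<and>
     best_reply y1 (utility_gap a11 a12 (d - e) y1 y2) \<and>
     best_reply y2 (utility_gap a21 a22 (d - e) y1 y2) \<and>
     nearby s1 (utility_gap a11 a12 d s1 s2) x1 (utility_gap a11 a12 (d + e) x1 x2) \<and>
     nearby s2 (utility_gap a21 a22 d s1 s2) x2 (utility_gap a21 a22 (d + e) x1 x2) \<and>
     nearby s1 (utility_gap a11 a12 d s1 s2) y1 (utility_gap a11 a12 (d - e) y1 y2) \<and>
     nearby s2 (utility_gap a21 a22 d s1 s2) y2 (utility_gap a21 a22 (d - e) y1 y2)"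

lemma demand_responsive_swap_groups:
  assumes "demand_responsive a11 a12 a21 a22 d e s1 s2 x1 x2 y1 y2"
  shows "demand_responsive a22 a21 a12 a11 d e s2 s1 x2 x1 y2 y1"
proof -
  have "utility_gap a b c s t = utility_gap b a c t s" for a b c s t
    by (simp add: utility_gap_def)
  then show ?thesis
    using assms unfolding demand_responsive_def by (metis add.commute)
qed

text \<open>Seen from firm \<open>b\<close>, the price difference and all shares are reflected. The
  rise of \<open>b\<close>'s price becomes the rise of the first firm's price, which is why the
  \<open>x\<close> and \<open>y\<close> profiles trade places.\<close>

lemma demand_responsive_swap_firms:
  assumes "demand_responsive a11 a12 a21 a22 d e s1 s2 x1 x2 y1 y2"
  shows "demand_responsive a11 a12 a21 a22 (- d) e
           (1 - s1) (1 - s2) (1 - y1) (1 - y2) (1 - x1) (1 - x2)"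
proof -
  have "- d + e = - (d - e)" "- d - e = - (d + e)"
    by auto
  then show ?thesis
    using assms
    unfolding demand_responsive_def
    by (simp only: utility_gap_reflect best_reply_reflect nearby_reflect) simp
qed

text \<open>Suppose group 1 is entirely with \<open>a\<close> and group 2 is not. When
  \<open>a\<close> raises its price, group 1 can become indifferent only if group 2 moves towards
  \<open>a\<close>; since total demand still falls, group 2 must weigh itself more than group 1.
  When \<open>b\<close> raises its price, group 2 stays indifferent while total demand for
  \<open>a\<close> rises, which that ordering of weights rules out.\<close>

lemma demand_responsive_first_one_imp_second_one:
  assumes resp: "demand_responsive a11 a12 a21 a22 d e s1 s2 x1 x2 y1 y2"
    and "s1 = 1"
  shows "s2 = 1"
proof (rule ccontr)
  assume "s2 \<noteq> 1"
  note unf = demand_responsive_def best_reply_def nearby_def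
  have nonneg: "0 \<le> a11" "0 \<le> a12" "0 \<le> a21" "0 \<le> a22" "0 < e"
    and xs: "x1 + x2 < 1 + s2" and ys: "1 + s2 < y1 + y2"
    using resp \<open>s1 = 1\<close> by (auto simp: unf)
  have bounds: "0 \<le> s2" "s2 < 1" "0 < x1" "x1 \<le> 1" "0 \<le> x2" "x2 < 1"
    "0 < y1" "y1 \<le> 1" "0 \<le> y2" "y2 < 1"
    using resp \<open>s1 = 1\<close> \<open>s2 \<noteq> 1\<close> by (auto simp: unf)
  have y2: "s2 < y2" using ys bounds by linarith
  then have gap2y: "utility_gap a21 a22 (d - e) y1 y2 = 0"
    using resp bounds by (auto simp: unf)
  \<comment> \<open>If \<open>s2 > 0\<close> group 2 is split. If \<open>s2 = 0\<close> its gap is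
    at most 0, and a negative gap would persist at \<open>y\<close>, against
    \<open>gap2y\<close>.\<close>
  then have gap2: "utility_gap a21 a22 d 1 s2 = 0"
    using resp bounds \<open>s1 = 1\<close> unfolding unf by (smt (verit))
  \<comment> \<open>Otherwise group 2 alone leaves \<open>a\<close>. Both the higher price and its
    own smaller share at \<open>a\<close> then push its gap strictly below 0, although it is split
    at \<open>x\<close>.\<close>
  have x1: "x1 < 1"
  proof (rule ccontr)
    assume "\<not> x1 < 1"
    then have "x1 = 1" using bounds by linarith
    then have "x2 < s2" using xs by linarith
    then have "utility_gap a21 a22 (d + e) x1 x2 = 0"
      using resp bounds unfolding unf by (smt (verit))
    then have "2 * (a22 * (s2 - x2)) = - e"
      using gap2 \<open>x1 = 1\<close> by (simp add: utility_gap_def algebra_simps)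
    moreover have "0 \<le> a22 * (s2 - x2)"
      using \<open>x2 < s2\<close> nonneg by simp
    ultimately show False using nonneg by linarith
  qed
  then have gap1x: "utility_gap a11 a12 (d + e) x1 x2 = 0"
    using resp bounds by (auto simp: unf)
  \<comment> \<open>A positive gap would persist at \<open>x\<close>, where it is 0.\<close>
  then have gap1: "utility_gap a11 a12 d 1 s2 = 0"
    using resp \<open>s1 = 1\<close> unfolding unf by (smt (verit))
  have "2 * (a12 * (x2 - s2)) = e + 2 * (a11 * (1 - x1))"
    using gap1 gap1x by (simp add: utility_gap_def algebra_simps)
  moreover have "0 \<le> a11 * (1 - x1)" using nonneg x1 by simp
  ultimately have "0 < a12 * (x2 - s2)" using nonneg by linarith
  then have x2: "s2 < x2" using nonneg by (simp add: zero_less_mult_iff)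
  then have gap2x: "utility_gap a21 a22 (d + e) x1 x2 = 0"
    using resp bounds by (auto simp: unf)
  have "2 * (a22 * (x2 - s2)) = e + 2 * (a21 * (1 - x1))"
    using gap2 gap2x by (simp add: utility_gap_def algebra_simps)
  \<comment> \<open>The fall of total demand says that group 2 gains less than group 1
    loses.\<close>
  moreover have "a21 * (x2 - s2) \<le> a21 * (1 - x1)"
    using nonneg xs by (intro mult_left_mono) auto
  ultimately have "a21 * (x2 - s2) < a22 * (x2 - s2)" using nonneg by linarith
  then have less: "a21 < a22" using x2 by simp
  have "2 * (a21 * (1 - y1)) = e + 2 * (a22 * (y2 - s2))"
    using gap2 gap2y by (simp add: utility_gap_def algebra_simps)
  moreover have "a21 * (1 - y1) \<le> a21 * (y2 - s2)"
    using nonneg ys by (intro mult_left_mono) auto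
  moreover have "a21 * (y2 - s2) \<le> a22 * (y2 - s2)"
    using less y2 by (intro mult_right_mono) auto
  ultimately show False using nonneg by linarith
qed

text \<open>By the symmetries of groups and firms, one group at a corner puts the other at the same
  corner, so total demand for \<open>a\<close> would be 0 or 2.\<close>

lemma demand_responsive_imp_split:
  assumes resp: "demand_responsive a11 a12 a21 a22 d e s1 s2 x1 x2 y1 y2"
    and "0 < s1 + s2" "s1 + s2 < 2"
  shows "0 < s1 \<and> s1 < 1 \<and> 0 < s2 \<and> s2 < 1"
proof -
  note firms = demand_responsive_swap_firms [OF resp]
  have "s1 = 1 \<Longrightarrow> s2 = 1"
    using demand_responsive_first_one_imp_second_one [OF resp] .
  moreover have "s2 = 1 \<Longrightarrow> s1 = 1"
    using demand_responsive_first_one_imp_second_one [OF demand_responsive_swap_groups [OF resp]] .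
  moreover have "s1 = 0 \<Longrightarrow> s2 = 0"
    using demand_responsive_first_one_imp_second_one [OF firms] by simp
  moreover have "s2 = 0 \<Longrightarrow> s1 = 0"
    using demand_responsive_first_one_imp_second_one [OF demand_responsive_swap_groups [OF firms]]
    by simp
  moreover have "0 \<le> s1" "s1 \<le> 1" "0 \<le> s2" "s2 \<le> 1"
    using resp by (auto simp: demand_responsive_def best_reply_def)
  ultimately show ?thesis
    using assms(2,3) by linarith
qed

section \<open>Neighborhoods of prices\<close>

lemma price_nhd_iff_ball:
  "price_nhd p P \<longleftrightarrow> P \<subseteq> price_space \<and> p \<in> price_space \<and> (\<exists>\<delta>>0. ball p \<delta> \<inter> price_space \<subseteq> P)"
proof (intro iffI conjI)
  assume "price_nhd p P"
  then obtain U where U: "P \<subseteq> price_space" "openin (top_of_set price_space) U" "p \<in> U" "U \<subseteq> P"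
    by (auto simp: price_nhd_def)
  show "P \<subseteq> price_space" "p \<in> price_space" using U by auto
  show "\<exists>\<delta>>0. ball p \<delta> \<inter> price_space \<subseteq> P"
    using U by (meson openin_contains_ball order_trans)
next
  assume *: "P \<subseteq> price_space \<and> p \<in> price_space \<and> (\<exists>\<delta>>0. ball p \<delta> \<inter> price_space \<subseteq> P)"
  then obtain \<delta> where \<delta>: "\<delta> > 0" "ball p \<delta> \<inter> price_space \<subseteq> P" by blast
  have "openin (top_of_set price_space) (ball p \<delta> \<inter> price_space)"
    by (metis inf_commute open_ball openin_open_Int)
  then show "price_nhd p P"
    unfolding price_nhd_def using * \<delta> by (metis IntI centre_in_ball)
qed

lemma price_nhd_continuous_tendsto:
  assumes "price_nhd p P" "continuous_on P \<sigma>"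
  shows "(\<sigma> \<longlongrightarrow> \<sigma> p) (at p within price_space)"
proof -
  obtain \<delta> where \<delta>: "\<delta> > 0" "ball p \<delta> \<inter> price_space \<subseteq> P" "P \<subseteq> price_space" "p \<in> price_space"
    using assms(1) by (auto simp: price_nhd_iff_ball)
  then have "p \<in> P" by auto
  then have "(\<sigma> \<longlongrightarrow> \<sigma> p) (at p within P)"
    using assms(2) by (simp add: continuous_on_def)
  moreover have "at p within P = at p within price_space"
    by (rule at_within_nhd [of _ "ball p \<delta>"]) (use \<delta> in auto)
  ultimately show ?thesis by simp
qed

text \<open>The filter \<open>at p\<close> ignores \<open>p\<close> itself; the assumption
  \<open>Q p\<close> fills the hole in the ball.\<close>

lemma eventually_price_ball:
  assumes "\<forall>\<^sub>F q in at p within price_space. Q q" "Q p"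
  obtains \<delta> where "\<delta> > 0" "\<And>q. q \<in> price_space \<Longrightarrow> dist q p < \<delta> \<Longrightarrow> Q q"
  using assms unfolding eventually_at by metis

lemma local_maximizer_on_nonneg_ball:
  assumes "local_maximizer_on {0..} f x" "0 < x"
  obtains \<delta> where "\<delta> > 0" "\<And>y. \<bar>x - y\<bar> < \<delta> \<Longrightarrow> f y \<le> f x"
proof -
  obtain \<delta> where \<delta>: "\<delta> > 0" "\<And>y. y \<in> {0..} \<Longrightarrow> y \<noteq> x \<Longrightarrow> dist y x < \<delta> \<Longrightarrow> f y \<le> f x"
    using assms unfolding local_maximizer_on_def eventually_at by metis
  show thesis
  proof
    \<comment> \<open>A radius of at most \<open>x\<close> keeps every tested price nonnegative, so
      the constraint disappears.\<close>
    show "0 < min \<delta> x" using \<delta> assms by simp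
    show "f y \<le> f x" if "\<bar>x - y\<bar> < min \<delta> x" for y
      using \<delta>(2) [of y] that by (cases "y = x") (auto simp: dist_real_def)
  qed
qed

section \<open>Second-stage equilibria\<close>

lemma stage2_best_reply:
  assumes "s \<in> stage2_equilibria \<alpha> p"
  shows "best_reply (s $ i) (value_diff \<alpha> p s i)"
  using assms by (auto simp: stage2_equilibria_def best_reply_def)

lemma value_diff_utility_gap:
  "value_diff \<alpha> p s i = utility_gap (\<alpha> $ i $ 1) (\<alpha> $ i $ 2) (fst p - snd p) (s $ 1) (s $ 2)"
  by (simp add: value_diff_def utility_gap_def)

lemma split_equilibrium_shares:
  assumes s: "s \<in> stage2_equilibria \<alpha> q" and split: "\<forall>i. 0 < s $ i \<and> s $ i < 1"
    and det: "det \<alpha> \<noteq> 0"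
  shows "s $ 1 = (1 + kappa1 \<alpha> * (fst q - snd q)) / 2"
    and "s $ 2 = (1 + kappa2 \<alpha> * (fst q - snd q)) / 2"
proof -
  define d where "d = fst q - snd q"
  define u where "u = 2 * s $ 1 - 1"
  define w where "w = 2 * s $ 2 - 1"
  have "value_diff \<alpha> q s i = 0" for i
    using s split by (auto simp: stage2_equilibria_def)
  from this[of 1] this[of 2]
  have 1: "\<alpha> $ 1 $ 1 * u + \<alpha> $ 1 $ 2 * w = d" and 2: "\<alpha> $ 2 $ 1 * u + \<alpha> $ 2 $ 2 * w = d"
    by (auto simp: value_diff_def u_def w_def d_def)
  \<comment> \<open>Cramer's rule: this combination of the two indifference equations eliminates
    \<open>w\<close>; the one below for \<open>w\<close> eliminates \<open>u\<close>.\<close>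
  have "det \<alpha> * u = \<alpha> $ 2 $ 2 * (\<alpha> $ 1 $ 1 * u + \<alpha> $ 1 $ 2 * w) -
      \<alpha> $ 1 $ 2 * (\<alpha> $ 2 $ 1 * u + \<alpha> $ 2 $ 2 * w)"
    by (simp add: det_2 algebra_simps)
  then have "det \<alpha> * u = (\<alpha> $ 2 $ 2 - \<alpha> $ 1 $ 2) * d"
    by (simp only: 1 2 left_diff_distrib)
  then have "u = kappa1 \<alpha> * d"
    using det by (simp add: kappa1_def field_simps)
  then show "s $ 1 = (1 + kappa1 \<alpha> * (fst q - snd q)) / 2"
    by (simp add: u_def d_def)
  have "det \<alpha> * w = \<alpha> $ 1 $ 1 * (\<alpha> $ 2 $ 1 * u + \<alpha> $ 2 $ 2 * w) -
      \<alpha> $ 2 $ 1 * (\<alpha> $ 1 $ 1 * u + \<alpha> $ 1 $ 2 * w)"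
    by (simp add: det_2 algebra_simps)
  then have "det \<alpha> * w = (\<alpha> $ 1 $ 1 - \<alpha> $ 2 $ 1) * d"
    by (simp only: 1 2 left_diff_distrib)
  then have "w = kappa2 \<alpha> * d"
    using det by (simp add: kappa2_def field_simps)
  then show "s $ 2 = (1 + kappa2 \<alpha> * (fst q - snd q)) / 2"
    by (simp add: w_def d_def)
qed

lemma split_demand:
  assumes "selection \<alpha> \<sigma>" "det \<alpha> \<noteq> 0" "q \<in> price_space" "\<forall>i. 0 < \<sigma> q $ i \<and> \<sigma> q $ i < 1"
  shows "demand_a \<sigma> q = 1 + (kappa1 \<alpha> + kappa2 \<alpha>) * (fst q - snd q) / 2"
    and "demand_b \<sigma> q = 1 + (kappa1 \<alpha> + kappa2 \<alpha>) * (snd q - fst q) / 2"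
proof -
  have "\<sigma> q \<in> stage2_equilibria \<alpha> q" using assms by (auto simp: selection_def)
  note sh = split_equilibrium_shares [OF this assms(4,2)]
  show "demand_a \<sigma> q = 1 + (kappa1 \<alpha> + kappa2 \<alpha>) * (fst q - snd q) / 2"
    and "demand_b \<sigma> q = 1 + (kappa1 \<alpha> + kappa2 \<alpha>) * (snd q - fst q) / 2"
    by (simp_all add: demand_a_def demand_b_def sh field_simps)
qed

lemma equilibrium_eventually_nearby:
  assumes tend: "(\<sigma> \<longlongrightarrow> \<sigma> p) (at p within price_space)"
  shows "\<forall>\<^sub>F q in at p within price_space.
           nearby (\<sigma> p $ i) (value_diff \<alpha> p (\<sigma> p) i) (\<sigma> q $ i) (value_diff \<alpha> q (\<sigma> q) i)"
proof -
  have t1: "((\<lambda>q. \<sigma> q $ i) \<longlongrightarrow> \<sigma> p $ i) (at p within price_space)"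
    using tend by (rule tendsto_vec_nth)
  have t2: "((\<lambda>q. value_diff \<alpha> q (\<sigma> q) i) \<longlongrightarrow> value_diff \<alpha> p (\<sigma> p) i) (at p within price_space)"
    unfolding value_diff_def by (intro tendsto_intros tend)
  show ?thesis
    unfolding nearby_def eventually_conj_iff
    by (auto intro: order_tendstoD [OF t1] order_tendstoD [OF t2])
qed

section \<open>Prices at a local maximum\<close>

text \<open>With positive demand, a higher price at undiminished demand would strictly increase
  profit.\<close>

lemma price_rise_lowers_demand:
  fixes x e D D' :: real
  assumes "(x + e) * D' \<le> x * D" "0 < x" "0 < e" "0 < D"
  shows "D' < D"
proof (rule ccontr)
  assume "\<not> D' < D"
  then have "(x + e) * D \<le> (x + e) * D'"
    using assms by (intro mult_left_mono) auto
  moreover have "x * D < (x + e) * D"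
    using assms by simp
  ultimately show False using assms by linarith
qed

text \<open>Only upward deviations are tested: one small rise \<open>e\<close>, made by each firm
  separately, yields the two profiles that \<open>demand_responsive\<close> compares with the one at
  \<open>p\<close>.\<close>

lemma local_maximum_imp_split:
  assumes \<alpha>: "\<forall>i j. \<alpha> $ i $ j \<ge> 0"
    and p: "p \<in> price_space" and sel: "selection \<alpha> \<sigma>"
    and tend: "(\<sigma> \<longlongrightarrow> \<sigma> p) (at p within price_space)"
    and max: "local_maximum \<sigma> p"
    and pos: "0 < fst p" "0 < snd p" "0 < demand_a \<sigma> p" "0 < demand_b \<sigma> p"
  shows "\<forall>i. 0 < \<sigma> p $ i \<and> \<sigma> p $ i < 1"
proof -
  let ?near = "\<lambda>q. \<forall>i. nearby (\<sigma> p $ i) (value_diff \<alpha> p (\<sigma> p) i) (\<sigma> q $ i) (value_diff \<alpha> q (\<sigma> q) i)"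
  have "\<forall>\<^sub>F q in at p within price_space. ?near q"
    by (intro eventually_all_finite equilibrium_eventually_nearby tend)
  moreover have "?near p" by (simp add: nearby_def)
  ultimately obtain \<delta> where \<delta>: "\<delta> > 0" "\<And>q. q \<in> price_space \<Longrightarrow> dist q p < \<delta> \<Longrightarrow> ?near q"
    by (rule eventually_price_ball [where Q = ?near]) blast
  obtain \<delta>a where \<delta>a: "\<delta>a > 0"
      "\<And>y. \<bar>fst p - y\<bar> < \<delta>a \<Longrightarrow> profit_a \<sigma> (y, snd p) \<le> profit_a \<sigma> (fst p, snd p)"
    using max pos unfolding local_maximum_def by (metis local_maximizer_on_nonneg_ball)
  obtain \<delta>b where \<delta>b: "\<delta>b > 0"
      "\<And>y. \<bar>snd p - y\<bar> < \<delta>b \<Longrightarrow> profit_b \<sigma> (fst p, y) \<le> profit_b \<sigma> (fst p, snd p)"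
    using max pos unfolding local_maximum_def by (metis local_maximizer_on_nonneg_ball)
  \<comment> \<open>Halving makes the common rise strictly smaller than all three radii.\<close>
  define e where "e = min \<delta> (min \<delta>a \<delta>b) / 2"
  have e: "0 < e" "e < \<delta>" "e < \<delta>a" "e < \<delta>b"
    using \<delta> \<delta>a \<delta>b by (auto simp: e_def)
  define qa where "qa = (fst p + e, snd p)"
  define qb where "qb = (fst p, snd p + e)"
  have q: "qa \<in> price_space" "qb \<in> price_space"
    using pos e by (auto simp: qa_def qb_def price_space_def)
  have "dist qa p = e" "dist qb p = e"
    using e by (cases p; simp add: qa_def qb_def dist_Pair_Pair dist_real_def)+
  then have near: "?near qa" "?near qb"
    using \<delta>(2) q e by auto
  have "profit_a \<sigma> qa \<le> profit_a \<sigma> p" "profit_b \<sigma> qb \<le> profit_b \<sigma> p"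
    using \<delta>a(2) [of "fst p + e"] \<delta>b(2) [of "snd p + e"] e by (auto simp: qa_def qb_def)
  then have "demand_a \<sigma> qa < demand_a \<sigma> p" "demand_b \<sigma> qb < demand_b \<sigma> p"
    using pos e
    by (auto simp: profit_a_def profit_b_def qa_def qb_def intro: price_rise_lowers_demand)
  then have less: "\<sigma> qa $ 1 + \<sigma> qa $ 2 < \<sigma> p $ 1 + \<sigma> p $ 2"
      "\<sigma> p $ 1 + \<sigma> p $ 2 < \<sigma> qb $ 1 + \<sigma> qb $ 2"
    by (auto simp: demand_a_def demand_b_def)
  have best: "best_reply (\<sigma> r $ i) (value_diff \<alpha> r (\<sigma> r) i)" if "r \<in> price_space" for r i
    using sel that by (auto simp: selection_def intro: stage2_best_reply)
  have d: "fst qa - snd qa = fst p - snd p + e" "fst qb - snd qb = fst p - snd p - e"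
    by (auto simp: qa_def qb_def)
  have "demand_responsive (\<alpha> $ 1 $ 1) (\<alpha> $ 1 $ 2) (\<alpha> $ 2 $ 1) (\<alpha> $ 2 $ 2) (fst p - snd p) e
      (\<sigma> p $ 1) (\<sigma> p $ 2) (\<sigma> qa $ 1) (\<sigma> qa $ 2) (\<sigma> qb $ 1) (\<sigma> qb $ 2)"
    unfolding demand_responsive_def
    using \<alpha> e less near best [OF p] best [OF q(1)] best [OF q(2)]
    by (simp add: value_diff_utility_gap d)
  from demand_responsive_imp_split [OF this] show ?thesis
    using pos by (simp add: demand_a_def demand_b_def forall_2)
qed

text \<open>The first-order condition for the profit at own price \<open>x\<close> against the rival
  price \<open>c\<close>, with demand of slope \<open>k / 2\<close>.\<close>

lemma quadratic_profit_max:
  fixes k x c :: real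
  assumes "0 < \<delta>"
    and "\<And>y. \<bar>x - y\<bar> < \<delta> \<Longrightarrow> y * (1 + k * (y - c) / 2) \<le> x * (1 + k * (x - c) / 2)"
  shows "k * (2 * x - c) = - 2"
proof -
  have "((\<lambda>y. y * (1 + k * (y - c) / 2)) has_real_derivative (1 + k * (2 * x - c) / 2)) (at x)"
    by (auto intro!: derivative_eq_intros simp: field_simps)
  then have "1 + k * (2 * x - c) / 2 = 0"
    by (rule DERIV_local_max [OF _ assms(1)]) (use assms(2) in blast)
  then show ?thesis by simp
qed

lemma equilibrium_prices:
  fixes k x y :: real
  assumes "k * (2 * x - y) = - 2" "k * (2 * y - x) = - 2" "0 < x"
  shows "k < 0 \<and> x = 2 / \<bar>k\<bar> \<and> y = 2 / \<bar>k\<bar>"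
proof -
  have "k \<noteq> 0" using assms by auto
  \<comment> \<open>The difference of the two first-order conditions.\<close>
  moreover have "3 * (k * (x - y)) = 0" using assms(1,2) by argo
  ultimately have "x = y" by simp
  with assms have kx: "k * x = - 2" by (simp add: algebra_simps)
  then have "k < 0" using \<open>0 < x\<close> by (smt (verit) mult_nonneg_nonneg)
  with kx \<open>x = y\<close> show ?thesis by (simp add: field_simps)
qed

lemma local_maximum_split_prices:
  assumes sel: "selection \<alpha> \<sigma>" and det: "det \<alpha> \<noteq> 0" and P: "price_nhd p P"
    and split: "\<forall>q\<in>P. \<forall>i. 0 < \<sigma> q $ i \<and> \<sigma> q $ i < 1"
    and max: "local_maximum \<sigma> p" and pos: "0 < fst p" "0 < snd p"
  shows "kappa1 \<alpha> + kappa2 \<alpha> < 0 \<and> fst p = 2 / \<bar>kappa1 \<alpha> + kappa2 \<alpha>\<bar> \<and>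
         snd p = 2 / \<bar>kappa1 \<alpha> + kappa2 \<alpha>\<bar>"
proof -
  let ?k = "kappa1 \<alpha> + kappa2 \<alpha>"
  obtain \<delta> where \<delta>: "\<delta> > 0" "ball p \<delta> \<inter> price_space \<subseteq> P" "p \<in> price_space"
    using P by (auto simp: price_nhd_iff_ball)
  have dem: "demand_a \<sigma> q = 1 + ?k * (fst q - snd q) / 2"
      "demand_b \<sigma> q = 1 + ?k * (snd q - fst q) / 2" if "q \<in> price_space" "dist p q < \<delta>" for q
  proof -
    have "q \<in> P" using \<delta> that by auto
    then show "demand_a \<sigma> q = 1 + ?k * (fst q - snd q) / 2"
      "demand_b \<sigma> q = 1 + ?k * (snd q - fst q) / 2"
      using split_demand [OF sel det that(1)] split by auto
  qed
  have distp: "dist p (y, snd p) = \<bar>fst p - y\<bar>" "dist p (fst p, y) = \<bar>snd p - y\<bar>" for y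
    by (cases p; simp add: dist_Pair_Pair dist_real_def)+
  obtain \<delta>a where \<delta>a: "\<delta>a > 0"
      "\<And>y. \<bar>fst p - y\<bar> < \<delta>a \<Longrightarrow> profit_a \<sigma> (y, snd p) \<le> profit_a \<sigma> (fst p, snd p)"
    using max pos unfolding local_maximum_def by (metis local_maximizer_on_nonneg_ball)
  obtain \<delta>b where \<delta>b: "\<delta>b > 0"
      "\<And>y. \<bar>snd p - y\<bar> < \<delta>b \<Longrightarrow> profit_b \<sigma> (fst p, y) \<le> profit_b \<sigma> (fst p, snd p)"
    using max pos unfolding local_maximum_def by (metis local_maximizer_on_nonneg_ball)
  have "?k * (2 * fst p - snd p) = - 2"
  proof (rule quadratic_profit_max)
    \<comment> \<open>The bound \<open>fst p\<close> keeps the deviations inside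
      \<open>price_space\<close>, where the demand formula is available.\<close>
    show "0 < min (fst p) (min \<delta> \<delta>a)" using \<delta> \<delta>a pos by simp
    fix y assume y: "\<bar>fst p - y\<bar> < min (fst p) (min \<delta> \<delta>a)"
    then have "(y, snd p) \<in> price_space" using pos by (auto simp: price_space_def)
    then show "y * (1 + ?k * (y - snd p) / 2) \<le> fst p * (1 + ?k * (fst p - snd p) / 2)"
      using \<delta>a(2) [of y] y dem(1) [of "(y, snd p)"] dem(1) [of p] \<delta>
      by (simp add: profit_a_def distp)
  qed
  moreover have "?k * (2 * snd p - fst p) = - 2"
  proof (rule quadratic_profit_max)
    show "0 < min (snd p) (min \<delta> \<delta>b)" using \<delta> \<delta>b pos by simp
    fix y assume y: "\<bar>snd p - y\<bar> < min (snd p) (min \<delta> \<delta>b)"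
    then have "(fst p, y) \<in> price_space" using pos by (auto simp: price_space_def)
    then show "y * (1 + ?k * (y - fst p) / 2) \<le> snd p * (1 + ?k * (snd p - fst p) / 2)"
      using \<delta>b(2) [of y] y dem(2) [of "(fst p, y)"] dem(2) [of p] \<delta>
      by (simp add: profit_b_def distp)
  qed
  ultimately show ?thesis
    using equilibrium_prices pos by blast
qed

section \<open>Converse direction: splitting at the symmetric price gives a local maximum\<close>

lemma quadratic_profit_le:
  fixes k x y :: real
  assumes "k < 0" "x = 2 / \<bar>k\<bar>"
  shows "y * (1 + k * (y - x) / 2) \<le> x"
proof -
  have kx: "k * x = - 2" using assms by (simp add: field_simps)
  \<comment> \<open>Completing the square: the loss from deviating to \<open>y\<close> is a
    nonnegative multiple of the squared deviation, since \<open>k < 0\<close>.\<close>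
  have "x - y * (1 + k * (y - x) / 2) = - k / 2 * (y - x)\<^sup>2"
    using kx by (simp add: field_simps power2_eq_square) algebra
  moreover have "0 \<le> - k / 2 * (y - x)\<^sup>2"
    using assms(1) by (intro mult_nonneg_nonneg) auto
  ultimately show ?thesis by linarith
qed

lemma split_prices_local_maximum:
  assumes sel: "selection \<alpha> \<sigma>" and det: "det \<alpha> \<noteq> 0" and P: "price_nhd p P"
    and split: "\<forall>q\<in>P. \<forall>i. 0 < \<sigma> q $ i \<and> \<sigma> q $ i < 1"
    and neg: "kappa1 \<alpha> + kappa2 \<alpha> < 0"
    and prices: "fst p = 2 / \<bar>kappa1 \<alpha> + kappa2 \<alpha>\<bar>" "snd p = 2 / \<bar>kappa1 \<alpha> + kappa2 \<alpha>\<bar>"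
  shows "continuous_on P \<sigma>" "local_maximum \<sigma> p" "profit_a \<sigma> p > 0" "profit_b \<sigma> p > 0"
proof -
  let ?k = "kappa1 \<alpha> + kappa2 \<alpha>"
  obtain \<delta> where \<delta>: "\<delta> > 0" "ball p \<delta> \<inter> price_space \<subseteq> P" "p \<in> price_space" "P \<subseteq> price_space"
    using P by (auto simp: price_nhd_iff_ball)
  then have "p \<in> P" by auto
  have pos: "0 < fst p" "0 < snd p" using neg prices by auto
  have dem: "demand_a \<sigma> q = 1 + ?k * (fst q - snd q) / 2"
      "demand_b \<sigma> q = 1 + ?k * (snd q - fst q) / 2" if "q \<in> P" for q
    using split_demand [OF sel det] split \<delta> that by blast+
  \<comment> \<open>At equal prices each firm serves half of the market, a demand of 1.\<close>
  have profits: "profit_a \<sigma> p = fst p" "profit_b \<sigma> p = snd p"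
    using dem [OF \<open>p \<in> P\<close>] prices by (simp_all add: profit_a_def profit_b_def)
  show "profit_a \<sigma> p > 0" "profit_b \<sigma> p > 0" using profits pos by auto
  have "continuous_on P (\<lambda>q. \<sigma> q $ i)" for i
  proof -
    have "\<sigma> q $ 1 = (1 + kappa1 \<alpha> * (fst q - snd q)) / 2"
      "\<sigma> q $ 2 = (1 + kappa2 \<alpha> * (fst q - snd q)) / 2" if "q \<in> P" for q
      using split_equilibrium_shares [of "\<sigma> q" \<alpha> q] sel split det \<delta> that
      by (auto simp: selection_def)
    moreover have "continuous_on P (\<lambda>q. (1 + c * (fst q - snd q)) / 2)" for c :: real
      by (intro continuous_intros) auto
    ultimately have "continuous_on P (\<lambda>q. \<sigma> q $ 1)" "continuous_on P (\<lambda>q. \<sigma> q $ 2)"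
      by (simp_all only: cong: continuous_on_cong)
    then show ?thesis
      using exhaust_2 [of i] by auto
  qed
  then have "continuous_on P (\<lambda>q. \<chi> i. \<sigma> q $ i)"
    by (rule continuous_on_vec_lambda)
  then show "continuous_on P \<sigma>" by simp
  have distp: "dist (y, snd p) p = dist y (fst p)" "dist (fst p, y) p = dist y (snd p)" for y
    by (cases p; simp add: dist_Pair_Pair)+
  have "local_maximizer_on {0..} (\<lambda>q. profit_a \<sigma> (q, snd p)) (fst p)"
    unfolding local_maximizer_on_def eventually_at
  proof (intro conjI exI ballI impI)
    show "fst p \<in> {0..}" using pos by simp
    show "0 < \<delta>" by (fact \<delta>)
    fix y assume y: "y \<in> {0..}" "y \<noteq> fst p \<and> dist y (fst p) < \<delta>"
    then have "(y, snd p) \<in> price_space" using pos by (simp add: price_space_def)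
    then have "(y, snd p) \<in> P" using \<delta>(2) y distp(1) [of y] by (auto simp: dist_commute)
    then have "profit_a \<sigma> (y, snd p) = y * (1 + ?k * (y - snd p) / 2)"
      by (simp add: profit_a_def dem)
    \<comment> \<open>The lemma bounds the profit by the rival's price \<open>snd p\<close>, which
      equals \<open>fst p\<close>.\<close>
    moreover have "... \<le> fst p"
      using quadratic_profit_le [OF neg prices(2), of y] prices by simp
    ultimately show "profit_a \<sigma> (y, snd p) \<le> profit_a \<sigma> (fst p, snd p)"
      by (simp only: prod.collapse profits)
  qed
  moreover have "local_maximizer_on {0..} (\<lambda>q. profit_b \<sigma> (fst p, q)) (snd p)"
    unfolding local_maximizer_on_def eventually_at
  proof (intro conjI exI ballI impI)
    show "snd p \<in> {0..}" using pos by simp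
    show "0 < \<delta>" by (fact \<delta>)
    fix y assume y: "y \<in> {0..}" "y \<noteq> snd p \<and> dist y (snd p) < \<delta>"
    then have "(fst p, y) \<in> price_space" using pos by (simp add: price_space_def)
    then have "(fst p, y) \<in> P" using \<delta>(2) y distp(2) [of y] by (auto simp: dist_commute)
    then have "profit_b \<sigma> (fst p, y) = y * (1 + ?k * (y - fst p) / 2)"
      by (simp add: profit_b_def dem)
    moreover have "... \<le> snd p"
      using quadratic_profit_le [OF neg prices(1), of y] prices by simp
    ultimately show "profit_b \<sigma> (fst p, y) \<le> profit_b \<sigma> (fst p, snd p)"
      by (simp only: prod.collapse profits)
  qed
  ultimately show "local_maximum \<sigma> p" by (simp add: local_maximum_def)
qed

theorem theorem1:
  fixes \<alpha> :: "real^2^2"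
    and p :: "real \<times> real"
    and \<sigma> :: "real \<times> real \<Rightarrow> real^2"
  assumes "\<forall>i j. \<alpha> $ i $ j \<ge> 0"
    and "det \<alpha> \<noteq> 0"
    and "p \<in> price_space"
    and "selection \<alpha> \<sigma>"
  shows "((\<exists>P. price_nhd p P \<and> continuous_on P \<sigma>) \<and> local_maximum \<sigma> p \<and>
            profit_a \<sigma> p > 0 \<and> profit_b \<sigma> p > 0)
         \<longleftrightarrow>
         (kappa1 \<alpha> + kappa2 \<alpha> < 0 \<and>
          (\<exists>P. price_nhd p P \<and> (\<forall>q\<in>P. \<forall>i. 0 < \<sigma> q $ i \<and> \<sigma> q $ i < 1)) \<and>
          fst p = 2 / \<bar>kappa1 \<alpha> + kappa2 \<alpha>\<bar> \<and> snd p = 2 / \<bar>kappa1 \<alpha> + kappa2 \<alpha>\<bar>)"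
proof (intro iffI, goal_cases)
  case 1
  then obtain P where P: "price_nhd p P" "continuous_on P \<sigma>"
    and max: "local_maximum \<sigma> p" and profit: "profit_a \<sigma> p > 0" "profit_b \<sigma> p > 0"
    by blast
  have pos: "0 < fst p" "0 < snd p" "0 < demand_a \<sigma> p" "0 < demand_b \<sigma> p"
    using profit assms(3)
    by (auto simp: profit_a_def profit_b_def price_space_def zero_less_mult_iff)
  have tend: "(\<sigma> \<longlongrightarrow> \<sigma> p) (at p within price_space)"
    using P by (rule price_nhd_continuous_tendsto)
  have splitp: "\<forall>i. 0 < \<sigma> p $ i \<and> \<sigma> p $ i < 1"
    using assms(1,3,4) tend max pos by (rule local_maximum_imp_split)
  \<comment> \<open>Splitting is an open condition on the shares, so continuity spreads it from
    \<open>p\<close> to nearby prices.\<close>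
  have "\<forall>\<^sub>F q in at p within price_space. \<forall>i. 0 < \<sigma> q $ i \<and> \<sigma> q $ i < 1"
    using splitp
    by (intro eventually_all_finite eventually_conj)
      (auto intro: order_tendstoD [OF tendsto_vec_nth [OF tend]])
  then obtain \<delta> where \<delta>: "\<delta> > 0"
      "\<And>q. q \<in> price_space \<Longrightarrow> dist q p < \<delta> \<Longrightarrow> \<forall>i. 0 < \<sigma> q $ i \<and> \<sigma> q $ i < 1"
    by (rule eventually_price_ball) (use splitp in auto)
  \<comment> \<open>The given \<open>P\<close> may contain prices at which some group does not
    split, so a relative ball serves as the neighborhood.\<close>
  have nhd: "price_nhd p (ball p \<delta> \<inter> price_space)"
    using \<delta> assms(3) by (auto simp: price_nhd_iff_ball)
  have split: "\<forall>q\<in>ball p \<delta> \<inter> price_space. \<forall>i. 0 < \<sigma> q $ i \<and> \<sigma> q $ i < 1"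
    using \<delta>(2) by (auto simp: dist_commute)
  show ?case
    using local_maximum_split_prices [OF assms(4,2) nhd split max pos(1,2)] nhd split by blast
next
  case 2
  then show ?case
    using split_prices_local_maximum [OF assms(4,2)] by blast
qed

end
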